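(* Let $n\ge2$. Let $\gamma_0:\mathbb{R}\to\mathbb{R}^n$ be a smooth curve parametrized by its arc-length. Assume that $\gamma_0$ is periodic with period $2\pi$ and that the holonomy of the induced normal connection along the closed curve $\gamma_0$ is trivial (so a parallel frame $g^0$ along $\gamma_0$ and its principal curvatures $k^0=(k^0_1,\ldots,k^0_{n-1})^t$ are periodic). Let $k=(k_1,\ldots,k_{n-1})^t:\mathbb{R}^2\to\mathbb{R}^{n-1}$ be the (smooth) solution of $$k_t=-\left(k_{xxx}+\tfrac32\|k\|^2k_x\right),\qquad k(x,0)=k^0(x),$$ and suppose $k(x,t)$ is periodic in $x$ with period $2\pi$. Then: (1) Let $g=(e_1,\ldots,e_n):\mathbb{R}^2\to SO(n)$ be the solution of $$g^{-1}g_x=\begin{pmatrix}0&-k^t\\ k&0\end{pmatrix},\qquad g^{-1}g_t=\begin{pmatrix}0&-z^t\\ z&\xi\end{pmatrix},\qquad g(0,0)=g^0(0),$$ where $z=-(k_{xx}+\frac12\|k\|^2k)$ and $\xi=(\xi_{ij})$, $\xi_{ij}=(k_i)_xk_j-k_i(k_j)_x$. Then $g(x,t)$ is periodic in $x$ with period $2\pi$ and $g(x,0)=g^0(x)$. (2) Let $Z=-\left(\frac{\|k\|^2}{2}e_1+\sum_{i=1}^{n-1}(k_i)_xe_{i+1}\right)$ and $c(t)=\int_0^tZ(0,t_1)\,dt_1$. Then $$\gamma(x,t)=\gamma_0(0)+c(t)+\int_0^xe_1(s,t)\,ds$$ is a solution of the geometric Airy curve flow $\gamma_t=-\left(\frac12\|H\|^2e_1+\nabla^\perp_{e_1}H(\gamma(\cdot,t))\right)$,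 it is periodic in $x$ with period $2\pi$, and $\gamma(x,0)=\gamma_0(x)$.
   Context: For a smooth curve $\gamma:\mathbb{R}\to\mathbb{R}^n$ parametrized by arc-length $x$, a parallel frame along $\gamma$ is a smooth map $g=(e_1,\ldots,e_n):\mathbb{R}\to SO(n)$ (columns $e_i$) with $e_1=\gamma_x$ and $e_2,\ldots,e_n$ parallel with respect to the induced normal connection $\nabla^\perp$; equivalently $g^{-1}g_x=\begin{pmatrix}0&-k^t\\ k&0\end{pmatrix}$ with $k=(k_1,\ldots,k_{n-1})^t$. The function $k_i$ is called the principal curvature of $\gamma$ with respect to $e_{i+1}$. In the flow equation, $e_1=\gamma_x/\|\gamma_x\|$ and $H(\gamma(\cdot,t))$ is the mean curvature (curvature) vector field of $\gamma(\cdot,t)$; in terms of a parallel frame, $H=\sum_ik_ie_{i+1}$ and $\nabla^\perp_{e_1}H=\sum_i(k_i)_xe_{i+1}$. *)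

theory Defs
  imports "HOL-Analysis.Analysis"
begin

text \<open>
  \<^bold>\<open>Conventions.\<close> The space of dimension \<open>n \<ge> 2\<close> is \<open>real ^ 'm option\<close> and the space of dimension
  \<open>n - 1\<close> is \<open>real ^ 'm\<close>, with \<open>n = CARD('m) + 1\<close>; as \<open>'m\<close> is an arbitrary nonempty finite type,
  every \<open>n \<ge> 2\<close> is covered. The index \<open>None\<close> plays the role of \<open>1\<close> and \<open>Some i\<close> that of \<open>i + 1\<close>, so
  that the frame vector \<open>e\<^sub>1\<close> is \<open>column None g\<close>, the frame vector \<open>e\<^sub>i\<^sub>+\<^sub>1\<close> is \<open>column (Some i) g\<close>, and
  matrices come with the block structure \<open>1 + (n - 1)\<close>.
\<close>

text \<open>\<open>C_k m f\<close> says that \<open>f\<close> is of class \<open>C\<^sup>m\<close> on the whole space, all iterated directional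
  derivatives being taken with the Frechet derivative.\<close>

fun C_k :: "nat \<Rightarrow> ('a::real_normed_vector \<Rightarrow> 'b::real_normed_vector) \<Rightarrow> bool" where
  "C_k 0 f \<longleftrightarrow> continuous_on UNIV f"
| "C_k (Suc m) f \<longleftrightarrow>
     (\<forall>x. f differentiable at x) \<and> (\<forall>v. C_k m (\<lambda>x. frechet_derivative f (at x) v))"

definition smooth :: "('a::real_normed_vector \<Rightarrow> 'b::real_normed_vector) \<Rightarrow> bool" where
  "smooth f \<longleftrightarrow> (\<forall>m. C_k m f)"

definition D :: "(real \<Rightarrow> 'a::real_normed_vector) \<Rightarrow> real \<Rightarrow> 'a" where
  "D f x = vector_derivative f (at x)"

definition Dx :: "(real \<Rightarrow> real \<Rightarrow> 'a::real_normed_vector) \<Rightarrow> real \<Rightarrow> real \<Rightarrow> 'a" where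
  "Dx f x t = vector_derivative (\<lambda>s. f s t) (at x)"

definition Dt :: "(real \<Rightarrow> real \<Rightarrow> 'a::real_normed_vector) \<Rightarrow> real \<Rightarrow> real \<Rightarrow> 'a" where
  "Dt f x t = vector_derivative (\<lambda>s. f x s) (at t)"

text \<open>Geometry of a regular, not necessarily unit speed, curve \<open>\<gamma>\<close>. Vector fields along \<open>\<gamma>\<close> are
  functions of the parameter of \<open>\<gamma>\<close>.\<close>

definition unit_tangent :: "(real \<Rightarrow> 'a::euclidean_space) \<Rightarrow> real \<Rightarrow> 'a" where
  "unit_tangent \<gamma> x = D \<gamma> x /\<^sub>R norm (D \<gamma> x)"

definition normal_part :: "(real \<Rightarrow> 'a::euclidean_space) \<Rightarrow> real \<Rightarrow> 'a \<Rightarrow> 'a" where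
  "normal_part \<gamma> x w = w - (w \<bullet> unit_tangent \<gamma> x) *\<^sub>R unit_tangent \<gamma> x"

text \<open>The derivative of \<open>v\<close> in the direction \<open>e\<^sub>1\<close>, i.e. with respect to arc length, followed by
  the projection to the normal space. On normal fields this is the induced normal connection
  \<open>\<nabla>\<^sup>\<bottom>\<close> in the direction \<open>e\<^sub>1\<close>.\<close>

definition normal_deriv ::
    "(real \<Rightarrow> 'a::euclidean_space) \<Rightarrow> (real \<Rightarrow> 'a) \<Rightarrow> real \<Rightarrow> 'a" where
  "normal_deriv \<gamma> v x = normal_part \<gamma> x (D v x /\<^sub>R norm (D \<gamma> x))"

text \<open>The trace of the second fundamental form, whose value on \<open>(e\<^sub>1, e\<^sub>1)\<close> is the normal part of
  the derivative of \<open>e\<^sub>1\<close> in the direction \<open>e\<^sub>1\<close>.\<close>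

definition mean_curvature :: "(real \<Rightarrow> 'a::euclidean_space) \<Rightarrow> real \<Rightarrow> 'a" where
  "mean_curvature \<gamma> = normal_deriv \<gamma> (unit_tangent \<gamma>)"

definition parallel_normal_field ::
    "(real \<Rightarrow> 'a::euclidean_space) \<Rightarrow> (real \<Rightarrow> 'a) \<Rightarrow> bool" where
  "parallel_normal_field \<gamma> v \<longleftrightarrow>
     smooth v \<and> (\<forall>x. v x \<bullet> D \<gamma> x = 0) \<and> (\<forall>x. normal_deriv \<gamma> v x = 0)"

text \<open>For a closed curve with period \<open>L\<close>, the holonomy of the normal connection is the endomorphism
  of the normal space at \<open>\<gamma> 0 = \<gamma> L\<close> that maps \<open>v 0\<close> to \<open>v L\<close> for every parallel normal field \<open>v\<close>
  (each normal vector at \<open>\<gamma> 0\<close> is \<open>v 0\<close> for exactly one such \<open>v\<close>).\<close>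

definition trivial_normal_holonomy :: "(real \<Rightarrow> 'a::euclidean_space) \<Rightarrow> real \<Rightarrow> bool" where
  "trivial_normal_holonomy \<gamma> L \<longleftrightarrow> (\<forall>v. parallel_normal_field \<gamma> v \<longrightarrow> v L = v 0)"

text \<open>\<open>rotation_matrix\<close> is membership in \<open>SO(n)\<close>.\<close>

definition parallel_frame ::
    "(real \<Rightarrow> real ^ 'm option) \<Rightarrow> (real \<Rightarrow> real ^ 'm::finite option ^ 'm option) \<Rightarrow> bool" where
  "parallel_frame \<gamma> g \<longleftrightarrow>
     smooth g \<and> (\<forall>x. rotation_matrix (g x)) \<and>
     (\<forall>x. column None (g x) = D \<gamma> x) \<and>
     (\<forall>i. parallel_normal_field \<gamma> (\<lambda>x. column (Some i) (g x)))"

text \<open>The lower left block \<open>k\<close> of \<open>g\<inverse> g\<^sub>x\<close>.\<close>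

definition principal_curvatures ::
    "(real \<Rightarrow> real ^ 'm::finite option ^ 'm option) \<Rightarrow> real \<Rightarrow> real ^ 'm" where
  "principal_curvatures g x = (\<chi> i. (matrix_inv (g x) ** D g x) $ Some i $ None)"

text \<open>The block matrix with rows \<open>(0, -v\<^sup>t)\<close> and \<open>(v, A)\<close>.\<close>

definition block_matrix ::
    "real ^ 'm \<Rightarrow> real ^ 'm ^ 'm \<Rightarrow> real ^ 'm::finite option ^ 'm option" where
  "block_matrix v A = (\<chi> a b.
     case a of
       None \<Rightarrow> (case b of None \<Rightarrow> 0 | Some j \<Rightarrow> - (v $ j))
     | Some i \<Rightarrow> (case b of None \<Rightarrow> v $ i | Some j \<Rightarrow> A $ i $ j))"

text \<open>A solution of the flow is a smooth family \<open>\<gamma> x t\<close> of regular curves, with parameter \<open>x\<close> and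
  time \<open>t\<close>.\<close>

definition geometric_airy_flow :: "(real \<Rightarrow> real \<Rightarrow> 'a::euclidean_space) \<Rightarrow> bool" where
  "geometric_airy_flow \<gamma> \<longleftrightarrow>
     smooth (\<lambda>(x, t). \<gamma> x t) \<and> (\<forall>x t. Dx \<gamma> x t \<noteq> 0) \<and>
     (\<forall>x t. let \<gamma>\<^sub>t = (\<lambda>s. \<gamma> s t); H = mean_curvature \<gamma>\<^sub>t in
        Dt \<gamma> x t =
          - (((norm (H x))\<^sup>2 / 2) *\<^sub>R unit_tangent \<gamma>\<^sub>t x + normal_deriv \<gamma>\<^sub>t H x))"

end

theory Submission
  imports Defs
begin

text \<open>
  Two solutions \<open>A\<close>, \<open>B\<close> in the orthogonal group of the same linear equation \<open>A' = A U\<close> have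
  \<open>A B\<^sup>t\<close> constant, as \<open>U\<close> is skew. Applied in \<open>x\<close> at \<open>t = 0\<close> this gives \<open>g(x, 0) = g\<^sub>0(x)\<close>; the
  trivial holonomy gives \<open>g(2\<pi>, 0) = g(0, 0)\<close>, which propagates first in \<open>t\<close> and then in \<open>x\<close>
  to the periodicity of \<open>g\<close>. Since \<open>g\<close> has locally bounded partial derivatives \<open>g U\<close> and \<open>g V\<close>,
  it is continuous, and then smooth by bootstrapping. The frame equations yield \<open>Z\<^sub>x = (e\<^sub>1)\<^sub>t\<close>,
  whence \<open>\<gamma>\<^sub>x = e\<^sub>1\<close> and \<open>\<gamma>\<^sub>t = Z\<close>, which is the right-hand side of the flow in terms of the frame.
\<close>

section \<open>Calculus of smooth functions\<close>

lemma C_k_SucD: "C_k (Suc m) f \<Longrightarrow> C_k m f"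
  by (induction m arbitrary: f)
    (auto simp: continuous_on_eq_continuous_at differentiable_imp_continuous_within)

lemma C_k_const: "C_k m (\<lambda>x. c)"
  by (induction m arbitrary: c) auto

text \<open>A Frechet derivative is unique, so the class can be checked with whichever formula
  \<open>f'\<close> a differentiation rule produces.\<close>

lemma C_k_Suc_iff:
  assumes "\<And>x. (f has_derivative f' x) (at x)"
  shows "C_k (Suc m) f \<longleftrightarrow> (\<forall>v. C_k m (\<lambda>x. f' x v))"
proof -
  have "frechet_derivative f (at x) = f' x" for x
    by (metis assms frechet_derivative_at)
  then show ?thesis
    using assms by (auto simp: differentiable_def)
qed

lemma C_k_has_derivative:
  "C_k (Suc m) f \<Longrightarrow> (f has_derivative frechet_derivative f (at x)) (at x)"
  by (simp add: frechet_derivative_works[symmetric])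

lemma C_k_linear:
  assumes "bounded_linear h" "C_k m f"
  shows "C_k m (\<lambda>x. h (f x))"
  using assms(2)
proof (induction m arbitrary: f)
  case 0
  then show ?case
    by (auto intro: bounded_linear.continuous_on[OF assms(1)])
next
  case (Suc m)
  have "((\<lambda>x. h (f x)) has_derivative (\<lambda>v. h (frechet_derivative f (at x) v))) (at x)" for x
    by (rule bounded_linear.has_derivative[OF assms(1) C_k_has_derivative[OF Suc.prems]])
  from C_k_Suc_iff[OF this] Suc show ?case by simp
qed

lemma C_k_add:
  assumes "C_k m f" "C_k m g"
  shows "C_k m (\<lambda>x. f x + g x)"
  using assms
proof (induction m arbitrary: f g)
  case 0
  then show ?case by (simp add: continuous_on_add)
next
  case (Suc m)
  have "((\<lambda>x. f x + g x) has_derivative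
      (\<lambda>v. frechet_derivative f (at x) v + frechet_derivative g (at x) v)) (at x)" for x
    by (intro has_derivative_add C_k_has_derivative[OF Suc.prems(1)] C_k_has_derivative[OF Suc.prems(2)])
  from C_k_Suc_iff[OF this] Suc show ?case by simp
qed

text \<open>The product rule gives two terms of the same bilinear shape whose arguments are of class
  \<open>m\<close>, so the induction closes when \<open>f\<close> and \<open>g\<close> vary. Scalar,
  inner and matrix products are all instances.\<close>

lemma C_k_bilinear:
  assumes "bounded_bilinear h" "C_k m f" "C_k m g"
  shows "C_k m (\<lambda>x. h (f x) (g x))"
  using assms(2,3)
proof (induction m arbitrary: f g)
  case 0
  then show ?case
    by (auto intro: bounded_bilinear.continuous_on[OF assms(1)])
next
  case (Suc m)
  have "((\<lambda>x. h (f x) (g x)) has_derivative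
      (\<lambda>v. h (f x) (frechet_derivative g (at x) v) + h (frechet_derivative f (at x) v) (g x))) (at x)" for x
    by (intro bounded_bilinear.FDERIV[OF assms(1)] C_k_has_derivative[OF Suc.prems(1)]
        C_k_has_derivative[OF Suc.prems(2)])
  from C_k_Suc_iff[OF this]
  have iff: "C_k (Suc m) (\<lambda>x. h (f x) (g x)) \<longleftrightarrow> (\<forall>v. C_k m (\<lambda>x.
      h (f x) (frechet_derivative g (at x) v) + h (frechet_derivative f (at x) v) (g x)))" .
  show ?case
    unfolding iff
    using Suc.prems by (intro allI C_k_add Suc.IH) (simp_all add: C_k_SucD del: C_k.simps, simp_all)
qed

lemma smooth_imp_continuous_on: "smooth f \<Longrightarrow> continuous_on UNIV f"
  using C_k.simps(1) unfolding smooth_def by blast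

lemma smooth_imp_differentiable: "smooth f \<Longrightarrow> f differentiable at x"
  using C_k.simps(2) unfolding smooth_def by blast

lemma smooth_frechet_derivative: "smooth f \<Longrightarrow> smooth (\<lambda>x. frechet_derivative f (at x) v)"
  using C_k.simps(2) unfolding smooth_def by blast

lemma smooth_const: "smooth (\<lambda>x. c)"
  by (simp add: smooth_def C_k_const)

lemma smooth_linear: "bounded_linear h \<Longrightarrow> smooth f \<Longrightarrow> smooth (\<lambda>x. h (f x))"
  by (simp add: smooth_def C_k_linear)

lemma smooth_add: "smooth f \<Longrightarrow> smooth g \<Longrightarrow> smooth (\<lambda>x. f x + g x)"
  by (simp add: smooth_def C_k_add)

lemma smooth_bilinear:
  "bounded_bilinear h \<Longrightarrow> smooth f \<Longrightarrow> smooth g \<Longrightarrow> smooth (\<lambda>x. h (f x) (g x))"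
  by (simp add: smooth_def C_k_bilinear)

lemma smooth_scaleR: "smooth f \<Longrightarrow> smooth g \<Longrightarrow> smooth (\<lambda>x. f x *\<^sub>R g x)"
  by (rule smooth_bilinear[OF bounded_bilinear_scaleR])

lemma smooth_minus: "smooth f \<Longrightarrow> smooth (\<lambda>x. - f x)"
  by (rule smooth_linear[OF bounded_linear_minus[OF bounded_linear_ident]])

lemma smooth_diff: "smooth f \<Longrightarrow> smooth g \<Longrightarrow> smooth (\<lambda>x. f x - g x)"
  using smooth_add[OF _ smooth_minus] by fastforce

lemma smooth_sum:
  "finite I \<Longrightarrow> (\<And>i. i \<in> I \<Longrightarrow> smooth (f i)) \<Longrightarrow> smooth (\<lambda>x. \<Sum>i\<in>I. f i x)"
  by (induction I rule: finite_induct) (auto intro: smooth_const smooth_add)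

section \<open>Functions of two real variables and their partial derivatives\<close>

lemma has_vector_derivative_Dx:
  assumes "smooth (\<lambda>(x, t). f x t)"
  shows "((\<lambda>s. f s t) has_vector_derivative Dx f x t) (at x)"
    and "Dx f x t = frechet_derivative (\<lambda>(x, t). f x t) (at (x, t)) (1, 0)"
proof -
  let ?F = "frechet_derivative (\<lambda>(x, t). f x t) (at (x, t))"
  have F: "((\<lambda>(x, t). f x t) has_derivative ?F) (at (x, t))"
    using smooth_imp_differentiable[OF assms] frechet_derivative_works by blast
  have "((\<lambda>s. (s, t)) has_derivative (\<lambda>h. (h, 0))) (at x)"
    by (auto intro!: derivative_eq_intros)
  from has_derivative_compose[OF this] F
  have "((\<lambda>s. f s t) has_derivative (\<lambda>h. ?F (h, 0))) (at x)"
    by fastforce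
  moreover have "?F (h, 0) = h *\<^sub>R ?F (1, 0)" for h
    using linear_scale[OF has_derivative_linear[OF F], of h "(1, 0)"] by simp
  then have "(\<lambda>h. ?F (h, 0)) = (\<lambda>h. h *\<^sub>R ?F (1, 0))"
    by (rule ext)
  ultimately have *: "((\<lambda>s. f s t) has_vector_derivative ?F (1, 0)) (at x)"
    unfolding has_vector_derivative_def by (metis (no_types, lifting))
  then show "Dx f x t = ?F (1, 0)"
    by (simp add: Dx_def vector_derivative_at)
  with * show "((\<lambda>s. f s t) has_vector_derivative Dx f x t) (at x)"
    by simp
qed

text \<open>The chain rule along \<open>s \<mapsto> (s, t)\<close> identifies the partial derivative
  with the Frechet derivative in the direction \<open>(1, 0)\<close>, and directional derivatives of
  a smooth map are smooth.\<close>

lemma smooth_Dx: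
  assumes "smooth (\<lambda>(x, t). f x t)"
  shows "smooth (\<lambda>(x, t). Dx f x t)"
  using smooth_frechet_derivative[OF assms, of "(1, 0)"]
  by (simp add: has_vector_derivative_Dx(2)[OF assms] case_prod_unfold)

text \<open>Total differentiability follows from both partial derivatives once one of them is
  jointly continuous; here it is the one in \<open>t\<close>.\<close>

lemma has_derivative_partials:
  fixes F :: "real \<Rightarrow> real \<Rightarrow> 'b::real_normed_vector"
  assumes x: "\<And>x t. ((\<lambda>s. F s t) has_vector_derivative Fx x t) (at x)"
    and t: "\<And>x t. ((\<lambda>s. F x s) has_vector_derivative Ft x t) (at t)"
    and cont: "continuous_on UNIV (\<lambda>(x, t). Ft x t)"
  shows "((\<lambda>(x, t). F x t) has_derivative
           (\<lambda>v. fst v *\<^sub>R Fx (fst p) (snd p) + snd v *\<^sub>R Ft (fst p) (snd p))) (at p)"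
proof -
  obtain x0 t0 where p: "p = (x0, t0)" by fastforce
  have "continuous (at (x0, t0) within UNIV \<times> UNIV)
      (\<lambda>(x, t). blinfun_scaleR_left (Ft x t))"
  proof -
    have "isCont (\<lambda>(x, t). Ft x t) (x0, t0)"
      using cont by (simp add: continuous_on_eq_continuous_at)
    then show ?thesis
      unfolding case_prod_unfold by (auto intro!: bounded_linear.continuous[OF bounded_linear_blinfun_scaleR_left])
  qed
  from has_derivative_partialsI[OF _ _ this, where f = F and fx = "\<lambda>h. h *\<^sub>R Fx x0 t0"] x t
  have "((\<lambda>(x, t). F x t) has_derivative
      (\<lambda>(a, b). a *\<^sub>R Fx x0 t0 + b *\<^sub>R Ft x0 t0)) (at (x0, t0))"
    by (simp add: has_vector_derivative_def)
  then show ?thesis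
    by (simp add: p case_prod_unfold)
qed

text \<open>This is the inductive step of the bootstrapping: a directional derivative of
  \<open>F\<close> is a constant linear combination of the two partials, so it inherits their
  class.\<close>

lemma C_k_Suc_partials:
  fixes F :: "real \<Rightarrow> real \<Rightarrow> 'b::real_normed_vector"
  assumes "\<And>x t. ((\<lambda>s. F s t) has_vector_derivative Fx x t) (at x)"
    and "\<And>x t. ((\<lambda>s. F x s) has_vector_derivative Ft x t) (at t)"
    and "C_k m (\<lambda>(x, t). Fx x t)" "C_k m (\<lambda>(x, t). Ft x t)"
  shows "C_k (Suc m) (\<lambda>(x, t). F x t)"
proof -
  have "C_k 0 (\<lambda>(x, t). Ft x t)"
    using assms(4) by (induction m) (auto dest: C_k_SucD simp del: C_k.simps)
  then have cont: "continuous_on UNIV (\<lambda>(x, t). Ft x t)"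
    by simp
  have "C_k m (\<lambda>p. fst v *\<^sub>R Fx (fst p) (snd p) + snd v *\<^sub>R Ft (fst p) (snd p))" for v :: "real \<times> real"
    using assms(3,4) unfolding case_prod_unfold
    by (intro C_k_add C_k_linear[OF bounded_linear_scaleR_right])
  then show ?thesis
    using C_k_Suc_iff[OF has_derivative_partials[OF assms(1,2) cont]] by blast
qed

text \<open>Partial derivatives alone do not force joint continuity. A local bound on the
  \<open>x\<close>-derivative makes \<open>F\<close> Lipschitz in \<open>x\<close> uniformly in
  nearby \<open>t\<close>; it then suffices to split \<open>F x t - F x0 t0\<close> at
  \<open>F x0 t\<close> and use continuity in \<open>t\<close> on the line
  \<open>x = x0\<close>.\<close>

lemma continuous_on_partial_bound:
  fixes F :: "real \<Rightarrow> real \<Rightarrow> 'b::real_normed_vector"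
  assumes x: "\<And>x t. ((\<lambda>s. F s t) has_vector_derivative Fx x t) (at x)"
    and t: "\<And>x. continuous_on UNIV (F x)"
    and bound: "\<And>x t. norm (Fx x t) \<le> B (x, t)"
    and B: "continuous_on UNIV B"
  shows "continuous_on UNIV (\<lambda>(x, t). F x t)"
proof -
  have "((\<lambda>p. F (fst p) (snd p)) \<longlongrightarrow> F x0 t0) (at (x0, t0))" for x0 t0
  proof -
    \<comment> \<open>On a small ball \<open>B\<close> varies by less than 1, so \<open>M\<close>
      bounds the \<open>x\<close>-derivative there and serves as the Lipschitz constant.\<close>
    define M where "M = B (x0, t0) + 1"
    have "(B \<longlongrightarrow> B (x0, t0)) (at (x0, t0))"
      using B by (simp add: continuous_on_eq_continuous_at isCont_def)
    then have "\<forall>\<^sub>F p in at (x0, t0). dist (B p) (B (x0, t0)) < 1"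
      by (rule tendstoD) simp
    then obtain d where d: "d > 0"
      "\<And>p. p \<noteq> (x0, t0) \<Longrightarrow> dist p (x0, t0) < d \<Longrightarrow> dist (B p) (B (x0, t0)) < 1"
      by (auto simp: eventually_at)
    have M: "B p \<le> M" if "dist p (x0, t0) < d" for p
      using d(2)[OF _ that] by (cases "p = (x0, t0)") (auto simp: M_def dist_real_def)
    have near: "norm (F x t - F x0 t) \<le> M * norm (x - x0)" if "dist (x, t) (x0, t0) < d" for x t
    proof (rule differentiable_bound[of "closed_segment x0 x" "\<lambda>s. F s t" "\<lambda>s h. h *\<^sub>R Fx s t"])
      fix s assume s: "s \<in> closed_segment x0 x"
      show "((\<lambda>s. F s t) has_derivative (\<lambda>h. h *\<^sub>R Fx s t)) (at s within closed_segment x0 x)"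
        using x[unfolded has_vector_derivative_def] has_derivative_at_withinI by blast
      \<comment> \<open>The horizontal segment from \<open>(x0, t)\<close> to \<open>(x, t)\<close>
        stays in the ball, because moving \<open>s\<close> towards \<open>x0\<close> only decreases
        the distance to the centre.\<close>
      have "dist (s, t) (x0, t0) \<le> dist (x, t) (x0, t0)"
        using segment_bound1[OF s] by (simp add: dist_Pair_Pair dist_real_def abs_le_square_iff)
      with that have "B (s, t) \<le> M"
        by (intro M) linarith
      then have "norm (Fx s t) \<le> M"
        using bound[of s t] by linarith
      then show "onorm (\<lambda>h. h *\<^sub>R Fx s t) \<le> M"
        by (simp add: onorm_scaleR_left onorm_id bounded_linear_ident)
    qed auto
    have "((\<lambda>p. F (fst p) (snd p) - F x0 (snd p)) \<longlongrightarrow> 0) (at (x0, t0))"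
    proof (rule Lim_null_comparison)
      show "\<forall>\<^sub>F p in at (x0, t0). norm (F (fst p) (snd p) - F x0 (snd p)) \<le> M * norm (fst p - x0)"
        using near d(1) by (auto simp: eventually_at intro!: exI[of _ d])
      show "((\<lambda>p. M * norm (fst p - x0)) \<longlongrightarrow> 0) (at (x0, t0))"
        by (auto intro!: tendsto_eq_intros)
    qed
    moreover have "((\<lambda>p. F x0 (snd p)) \<longlongrightarrow> F x0 t0) (at (x0, t0))"
    proof -
      have "isCont (F x0) t0"
        using t by (simp add: continuous_on_eq_continuous_at)
      moreover have "(snd \<longlongrightarrow> t0) (at (x0, t0))"
        by (auto intro!: tendsto_eq_intros)
      ultimately show ?thesis
        by (rule isCont_tendsto_compose)
    qed
    ultimately have "((\<lambda>p. (F (fst p) (snd p) - F x0 (snd p)) + F x0 (snd p)) \<longlongrightarrow> 0 + F x0 t0) (at (x0, t0))"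
      by (rule tendsto_add)
    then show ?thesis
      by simp
  qed
  then show ?thesis
    by (auto simp: continuous_on_eq_continuous_at isCont_def case_prod_unfold)
qed

section \<open>Translation, constancy, and integrals with variable endpoint or parameter\<close>

lemma has_vector_derivative_translate:
  "((\<lambda>s. f (s + a)) has_vector_derivative f') (at x) \<longleftrightarrow> (f has_vector_derivative f') (at (x + a))"
proof -
  have *: "((\<lambda>s. h (s + b)) has_vector_derivative f') (at y)"
    if "(h has_vector_derivative f') (at (y + b))" for h b y
  proof -
    have "((\<lambda>s. s + b) has_vector_derivative 1) (at y)"
      by (auto intro!: derivative_eq_intros)
    from vector_diff_chain_at[OF this that] show ?thesis
      by (simp add: o_def)
  qed
  show ?thesis
    using *[of "\<lambda>s. f (s + a)" "x + a" "- a"] *[of f x a] by auto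
qed

lemma has_vector_derivative_zero_constant:
  fixes f :: "real \<Rightarrow> 'b::real_normed_vector"
  assumes "\<And>x. (f has_vector_derivative 0) (at x)"
  shows "f x = f y"
  using has_derivative_zero_constant[of UNIV f] assms
  by (auto simp: has_vector_derivative_def)

lemma has_vector_derivative_interval_integral_upper:
  fixes f :: "real \<Rightarrow> 'a::euclidean_space"
  assumes "continuous_on UNIV f"
  shows "((\<lambda>u. LBINT y=ereal 0..ereal u. f y) has_vector_derivative f x) (at x)"
proof -
  \<comment> \<open>The interval contains 0 and has \<open>x\<close> in its interior, so the
    one-sided restrictions disappear and both signs of \<open>x\<close> are treated at once.\<close>
  have "((\<lambda>u. LBINT y=ereal 0..ereal u. f y) has_vector_derivative f x)
      (at x within {- \<bar>x\<bar> - 1..\<bar>x\<bar> + 1})"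
    by (rule interval_integral_FTC2) (use assms continuous_on_subset in auto)
  moreover have "at x within {- \<bar>x\<bar> - 1..\<bar>x\<bar> + 1} = at x"
    by (rule at_within_interior) (simp, arith)
  ultimately show ?thesis by simp
qed

lemma has_vector_derivative_interval_integral_parameter:
  fixes f f' :: "real \<Rightarrow> real \<Rightarrow> 'a::euclidean_space"
  assumes f: "\<And>t. continuous_on UNIV (\<lambda>s. f s t)"
    and f': "\<And>s t. ((\<lambda>t. f s t) has_vector_derivative f' s t) (at t)"
    and cont: "continuous_on UNIV (\<lambda>(s, t). f' s t)"
  shows "((\<lambda>t. LBINT s=ereal 0..ereal x. f s t) has_vector_derivative
           (LBINT s=ereal 0..ereal x. f' s t)) (at t)"
proof -
  have f'_cont: "continuous_on UNIV (\<lambda>s. f' s t)" for t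
    using continuous_on_compose2[OF cont, of UNIV "\<lambda>s. (s, t)"]
    by (simp add: continuous_on_Pair continuous_on_id)
  have swap: "continuous_on (UNIV \<times> S) (\<lambda>(t, s). f' s t)" for S
    using continuous_on_compose2[OF cont, of "UNIV \<times> S" "\<lambda>p. (snd p, fst p)"]
    by (simp add: continuous_on_Pair continuous_on_fst continuous_on_snd continuous_on_id case_prod_unfold)
  have *: "((\<lambda>t. LBINT s=ereal a..ereal b. f s t) has_vector_derivative
      (LBINT s=ereal a..ereal b. f' s t)) (at t)" if "a \<le> b" for a b
  proof -
    \<comment> \<open>The Leibniz rule concerns the gauge integral over a box; for continuous
      integrands it agrees with the oriented Lebesgue integral.\<close>
    have eq: "(LBINT s=ereal a..ereal b. h s) = integral (cbox a b) h"
      if "continuous_on UNIV h" for h :: "real \<Rightarrow> 'a"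
      using that \<open>a \<le> b\<close> borel_integrable_atLeastAtMost'[of a b h] continuous_on_subset
      by (auto intro!: interval_integral_eq_integral)
    have "((\<lambda>t. integral (cbox a b) (\<lambda>s. f s t)) has_vector_derivative
        integral (cbox a b) (\<lambda>s. f' s t)) (at t within UNIV)"
      by (rule leibniz_rule_vector_derivative)
        (use f f' swap in \<open>auto intro!: integrable_continuous_real intro: continuous_on_subset\<close>)
    then show ?thesis
      by (simp add: eq f f'_cont)
  qed
  show ?thesis
  proof (cases "0 \<le> x")
    case False
    \<comment> \<open>For negative \<open>x\<close> the oriented integral is minus the one over
      \<open>[x, 0]\<close>.\<close>
    have "((\<lambda>t. - (LBINT s=ereal x..ereal 0. f s t)) has_vector_derivative
        - (LBINT s=ereal x..ereal 0. f' s t)) (at t)"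
      using * False by (intro has_vector_derivative_minus) auto
    then show ?thesis
      unfolding interval_integral_endpoints_reverse[of "ereal 0" "ereal x"] .
  qed (use * in auto)
qed

section \<open>Orthogonal frames\<close>

lemma bounded_bilinear_matrix_mult:
  "bounded_bilinear ((**) :: real^'n^'m \<Rightarrow> real^'p^'n \<Rightarrow> real^'p^'m)"
proof -
  have "bilinear ((**) :: real^'n^'m \<Rightarrow> real^'p^'n \<Rightarrow> real^'p^'m)"
    unfolding bilinear_def
    by (auto intro!: linearI simp: matrix_add_ldistrib matrix_scalar_ac scalar_matrix_assoc
        matrix_matrix_mult_def vec_eq_iff sum.distrib sum_distrib_left algebra_simps)
  then show ?thesis
    by (simp add: bilinear_conv_bounded_bilinear)
qed

lemma bounded_linear_transpose: "bounded_linear (transpose :: real^'n^'m \<Rightarrow> real^'m^'n)"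
  unfolding linear_conv_bounded_linear[symmetric]
  by (auto intro!: linearI simp: transpose_def vec_eq_iff)

lemma bounded_linear_column: "bounded_linear (column a :: real^'n^'m \<Rightarrow> real^'m)"
  unfolding linear_conv_bounded_linear[symmetric]
  by (auto intro!: linearI simp: column_def vec_eq_iff)

lemma transpose_matrix_mult_component:
  "(transpose A ** B) $ i $ j = column i A \<bullet> column j B" for A :: "real^'n^'m" and B :: "real^'p^'m"
  by (simp add: matrix_matrix_mult_def transpose_def column_def inner_vec_def)

lemma rotation_matrix_columns:
  fixes Q :: "real^'n^'n"
  shows "rotation_matrix Q \<Longrightarrow> column a Q \<bullet> column b Q = (if a = b then 1 else 0)"
  using transpose_matrix_mult_component[of Q Q a b]
  by (simp add: rotation_matrix_def orthogonal_matrix mat_def)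

lemma matrix_inv_orthogonal:
  fixes Q :: "real^'n^'n"
  assumes "orthogonal_matrix Q"
  shows "matrix_inv Q = transpose Q"
proof -
  have Q: "Q ** transpose Q = mat 1" "transpose Q ** Q = mat 1"
    using assms by (auto simp: orthogonal_matrix_def)
  \<comment> \<open>\<open>matrix_inv\<close> is a choice among two-sided inverses; the transpose
    shows that one exists, and uniqueness of inverses then identifies it.\<close>
  then have "matrix_inv Q ** Q = mat 1"
    unfolding matrix_inv_def by (metis (mono_tags, lifting) someI_ex)
  then show ?thesis
    by (metis Q(1) matrix_mul_assoc matrix_mul_lid matrix_mul_rid)
qed

lemma matrix_inv_mult_eq:
  fixes Q :: "real^'n^'n"
  assumes "orthogonal_matrix Q" "matrix_inv Q ** A = M"
  shows "A = Q ** M"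
proof -
  have "Q ** (transpose Q ** A) = A"
    using assms(1) by (simp add: matrix_mul_assoc orthogonal_matrix_def)
  then show ?thesis
    using assms by (simp add: matrix_inv_orthogonal)
qed

text \<open>Every row is a unit vector, so the Euclidean norm is at most the number of rows. All
  that matters is that the bound is the same for all orthogonal matrices.\<close>

lemma norm_orthogonal_matrix_le:
  fixes Q :: "real^'n^'n"
  assumes "orthogonal_matrix Q"
  shows "norm Q \<le> CARD('n)"
proof -
  have "norm (Q $ i) = 1" for i
    using assms unfolding orthogonal_matrix_orthonormal_rows row_def by simp
  then show ?thesis
    unfolding norm_vec_def[of Q] using L2_set_le_sum[of UNIV "\<lambda>i. norm (Q $ i)"] by simp
qed

text \<open>Differentiating \<open>transpose (A x) ** A x = mat 1\<close> leaves
  \<open>U + transpose U = 0\<close>.\<close>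

lemma orthogonal_solution_skew:
  fixes A :: "real \<Rightarrow> real^'n^'n"
  assumes A: "(A has_vector_derivative A x ** U) (at x)"
    and orth: "\<And>x. orthogonal_matrix (A x)"
  shows "transpose U = - U"
proof -
  have I: "transpose (A x) ** A x = mat 1" for x
    using orth by (simp add: orthogonal_matrix)
  have "((\<lambda>x. transpose (A x) ** A x) has_vector_derivative
      transpose (A x) ** (A x ** U) + transpose (A x ** U) ** A x) (at x)"
    by (intro bounded_bilinear.has_vector_derivative[OF bounded_bilinear_matrix_mult] A
        bounded_linear.has_vector_derivative[OF bounded_linear_transpose])
  then have "((\<lambda>x. mat 1) has_vector_derivative U + transpose U) (at x)"
    unfolding I matrix_transpose_mul matrix_mul_assoc[symmetric]
    by (simp add: matrix_mul_assoc[of "transpose (A x)"] I)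
  then have "U + transpose U = 0"
    using vector_derivative_unique_at has_vector_derivative_const by blast
  then show ?thesis
    by (simp add: eq_neg_iff_add_eq_0 add.commute)
qed

text \<open>The derivative of \<open>A x ** transpose (B x)\<close> is
  \<open>A x ** (transpose (U x) + U x) ** transpose (B x)\<close>. Skewness of \<open>U\<close> is
  derived from the orthogonality of \<open>A\<close>.\<close>

lemma orthogonal_solution_unique:
  fixes A B :: "real \<Rightarrow> real^'n^'n"
  assumes A: "\<And>x. (A has_vector_derivative A x ** U x) (at x)"
    and B: "\<And>x. (B has_vector_derivative B x ** U x) (at x)"
    and orth: "\<And>x. orthogonal_matrix (A x)" "\<And>x. orthogonal_matrix (B x)"
    and eq: "A a = B a"
  shows "A x = B x"
proof -
  have skew: "transpose (U x) = - U x" for x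
    by (rule orthogonal_solution_skew[OF A orth(1)])
  have neg: "A x ** - M = - (A x ** M)" for x M
    by (rule bounded_bilinear.minus_right[OF bounded_bilinear_matrix_mult])
  have neg': "- M ** C = - (M ** C)" for M C :: "real^'n^'n"
    by (rule bounded_bilinear.minus_left[OF bounded_bilinear_matrix_mult])
  have "((\<lambda>x. A x ** transpose (B x)) has_vector_derivative
      A x ** transpose (B x ** U x) + (A x ** U x) ** transpose (B x)) (at x)" for x
    by (intro bounded_bilinear.has_vector_derivative[OF bounded_bilinear_matrix_mult] A B
        bounded_linear.has_vector_derivative[OF bounded_linear_transpose])
  then have "((\<lambda>x. A x ** transpose (B x)) has_vector_derivative 0) (at x)" for x
    by (simp add: matrix_transpose_mul skew neg neg' matrix_mul_assoc)
  then have "A x ** transpose (B x) = A a ** transpose (B a)"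
    by (rule has_vector_derivative_zero_constant)
  then have "A x ** transpose (B x) = mat 1"
    using orth(2)[of a] eq by (simp add: orthogonal_matrix_def)
  then have "A x ** (transpose (B x) ** B x) = B x"
    by (simp add: matrix_mul_assoc)
  then show ?thesis
    using orth(2)[of x] by (simp add: orthogonal_matrix_def)
qed

text \<open>Only separate differentiability of \<open>g\<close> is given. Orthogonal matrices are
  bounded, so \<open>g ** U\<close> is dominated by a continuous function of \<open>U\<close> alone,
  which yields joint continuity. After that, if \<open>g\<close> is of class \<open>m\<close>, so
  are its partials \<open>g ** U\<close> and \<open>g ** V\<close>, and \<open>g\<close> gains one
  order.\<close>

lemma smooth_orthogonal_solution:
  fixes g :: "real \<Rightarrow> real \<Rightarrow> real^'n^'n"
  assumes x: "\<And>x t. ((\<lambda>s. g s t) has_vector_derivative g x t ** U x t) (at x)"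
    and t: "\<And>x t. ((\<lambda>s. g x s) has_vector_derivative g x t ** V x t) (at t)"
    and orth: "\<And>x t. orthogonal_matrix (g x t)"
    and U: "smooth (\<lambda>(x, t). U x t)" and V: "smooth (\<lambda>(x, t). V x t)"
  shows "smooth (\<lambda>(x, t). g x t)"
proof -
  obtain K where K: "K \<ge> 0" "\<And>(M :: real^'n^'n) (N :: real^'n^'n). norm (M ** N) \<le> norm M * norm N * K"
    using bounded_bilinear.nonneg_bounded[OF bounded_bilinear_matrix_mult] by blast
  have bound: "norm (g x t ** U x t) \<le> CARD('n) * norm (U x t) * K" for x t
    using K(2)[of "g x t" "U x t"] norm_orthogonal_matrix_le[OF orth, of x t]
    by (meson K(1) mult_right_mono norm_ge_zero order_trans)
  have "C_k m (\<lambda>(x, t). g x t)" for m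
  proof (induction m)
    case 0
    have "continuous_on UNIV (\<lambda>(x, t). g x t)"
    proof (rule continuous_on_partial_bound[OF x, where B = "\<lambda>(x, t). CARD('n) * norm (U x t) * K"])
      show "continuous_on UNIV (g x)" for x
        using t by (auto intro!: continuous_at_imp_continuous_on has_vector_derivative_continuous)
      show "continuous_on UNIV (\<lambda>(x, t). CARD('n) * norm (U x t) * K)"
        using smooth_imp_continuous_on[OF U] unfolding case_prod_unfold
        by (intro continuous_on_mult continuous_on_const continuous_on_norm)
    qed (use bound in auto)
    then show ?case by simp
  next
    case (Suc m)
    have "C_k m (\<lambda>(x, t). g x t ** U x t)" "C_k m (\<lambda>(x, t). g x t ** V x t)"
      using C_k_bilinear[OF bounded_bilinear_matrix_mult Suc] U V
      by (auto simp: smooth_def case_prod_unfold)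
    then show ?case
      by (rule C_k_Suc_partials[OF x t])
  qed
  then show ?thesis
    by (simp add: smooth_def)
qed

section \<open>Block structure and the equations of a parallel frame\<close>

lemma sum_UNIV_option: "(\<Sum>a\<in>UNIV. f a) = f None + (\<Sum>i\<in>UNIV. f (Some i))"
  for f :: "'m::finite option \<Rightarrow> 'b::comm_monoid_add"
  by (simp add: UNIV_option_conv sum.reindex)

lemma column_matrix_mult: "column a (Q ** M) = (\<Sum>b\<in>UNIV. M $ b $ a *\<^sub>R column b Q)"
  for Q :: "real^'n^'m" and M :: "real^'p^'n"
  by (simp add: vec_eq_iff column_def matrix_matrix_mult_def mult.commute)

text \<open>Applied to the matrix equations for \<open>g\<close>, this gives the derivative of each
  frame vector: with the blocks \<open>k\<close> and 0, the first vector moves by the combination of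
  the normal vectors with coefficients \<open>k\<close>, and each normal vector moves only along the
  tangent.\<close>

lemma column_mult_block_matrix:
  fixes Q :: "real ^ 'm::finite option ^ 'm option"
  shows "column None (Q ** block_matrix v A) = (\<Sum>i\<in>UNIV. v $ i *\<^sub>R column (Some i) Q)"
    and "column (Some j) (Q ** block_matrix v A) =
      - (v $ j) *\<^sub>R column None Q + (\<Sum>i\<in>UNIV. A $ i $ j *\<^sub>R column (Some i) Q)"
  by (simp_all add: column_matrix_mult sum_UNIV_option block_matrix_def)

text \<open>The block matrix is the sum of two linear maps, one for each block.\<close>

lemma smooth_block_matrix:
  fixes u :: "'a::real_normed_vector \<Rightarrow> real ^ 'm::finite"
  assumes "smooth u" "smooth A"
  shows "smooth (\<lambda>x. block_matrix (u x) (A x))"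
proof -
  have u: "linear (\<lambda>v :: real ^ 'm. block_matrix v 0)"
    by (rule linearI) (simp_all add: block_matrix_def vec_eq_iff split: option.split)
  have A: "linear (\<lambda>M :: real ^ 'm ^ 'm. block_matrix 0 M)"
    by (rule linearI) (simp_all add: block_matrix_def vec_eq_iff split: option.split)
  have "smooth (\<lambda>x. block_matrix (u x) 0 + block_matrix 0 (A x))"
    by (rule smooth_add[OF smooth_linear[OF u[unfolded linear_conv_bounded_linear] assms(1)]
          smooth_linear[OF A[unfolded linear_conv_bounded_linear] assms(2)]])
  moreover have "block_matrix v 0 + block_matrix 0 M = block_matrix v M" for v :: "real ^ 'm" and M
    by (simp add: block_matrix_def vec_eq_iff split: option.splits)
  ultimately show ?thesis
    by simp
qed

text \<open>The matrix \<open>A\<close>, which is the inverse of \<open>g\<close> times its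
  derivative, is skew. Its first column below the corner is \<open>principal_curvatures\<close> by
  definition, its first row follows by skewness, and its lower right block vanishes because parallel
  normal vectors have tangential derivatives.\<close>

lemma parallel_frame_derivative:
  assumes frame: "parallel_frame \<gamma> g" and unit: "\<And>x. norm (D \<gamma> x) = 1"
  shows "(g has_vector_derivative g x ** block_matrix (principal_curvatures g x) 0) (at x)"
proof -
  have rot: "rotation_matrix (g x)" for x
    using frame by (simp add: parallel_frame_def)
  then have orth: "orthogonal_matrix (g x)" for x
    by (simp add: rotation_matrix_def)
  have deriv: "(g has_vector_derivative D g x) (at x)"
    unfolding D_def vector_derivative_works[symmetric]
    using frame by (simp add: parallel_frame_def smooth_imp_differentiable)
  have tangent: "unit_tangent \<gamma> x = column None (g x)"
    using frame unit by (simp add: parallel_frame_def unit_tangent_def)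
  define A where "A = transpose (g x) ** D g x"
  have A: "A = matrix_inv (g x) ** D g x"
    by (simp add: A_def matrix_inv_orthogonal orth)
  have Dg: "D g x = g x ** A"
    by (rule matrix_inv_mult_eq[OF orth A[symmetric]])
  have "transpose A = - A"
    by (rule orthogonal_solution_skew[OF deriv[unfolded Dg] orth])
  then have "transpose A $ b $ a = (- A) $ b $ a" for a b
    by (rule arg_cong[where f = "\<lambda>M. M $ b $ a"])
  then have skew: "A $ a $ b = - (A $ b $ a)" for a b
    unfolding transpose_def vec_lambda_beta vector_uminus_component .
  have normal: "A $ Some i $ Some j = 0" for i j
  proof -
    let ?v = "\<lambda>x. column (Some j) (g x)"
    have "(?v has_vector_derivative column (Some j) (D g x)) (at x)"
      by (rule bounded_linear.has_vector_derivative[OF bounded_linear_column deriv])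
    then have "D ?v x = column (Some j) (D g x)"
      by (simp add: D_def vector_derivative_at)
    moreover have "normal_deriv \<gamma> ?v x = 0"
      using frame by (simp add: parallel_frame_def parallel_normal_field_def)
    \<comment> \<open>At unit speed the normal connection is the projected
      \<open>x\<close>-derivative; its vanishing leaves just the tangential component.\<close>
    ultimately have tangential: "column (Some j) (D g x) =
        (column (Some j) (D g x) \<bullet> column None (g x)) *\<^sub>R column None (g x)"
      by (simp add: normal_deriv_def normal_part_def unit tangent)
    have "A $ Some i $ Some j = column (Some i) (g x) \<bullet> column (Some j) (D g x)"
      by (simp add: A_def transpose_matrix_mult_component)
    also have "\<dots> = column (Some i) (g x) \<bullet>
        ((column (Some j) (D g x) \<bullet> column None (g x)) *\<^sub>R column None (g x))"
      using tangential by (rule arg_cong)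
    also have "\<dots> = 0"
      by (simp add: rotation_matrix_columns[OF rot])
    finally show ?thesis .
  qed
  have "A = block_matrix (principal_curvatures g x) 0"
  proof -
    have "A $ a $ b = block_matrix (principal_curvatures g x) 0 $ a $ b" for a b
    proof (cases a; cases b)
      assume "a = None" "b = None"
      then show ?thesis
        using skew[of None None] by (simp add: block_matrix_def)
    next
      fix j assume "a = None" "b = Some j"
      then show ?thesis
        using skew[of None "Some j"]
        by (simp add: block_matrix_def principal_curvatures_def A[symmetric])
    next
      fix i assume "a = Some i" "b = None"
      then show ?thesis
        by (simp add: block_matrix_def principal_curvatures_def A[symmetric])
    next
      fix i j assume "a = Some i" "b = Some j"
      then show ?thesis
        by (simp add: block_matrix_def normal)
    qed
    then show ?thesis
      by (simp add: vec_eq_iff)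
  qed
  with deriv Dg show ?thesis
    by simp
qed

section \<open>The flow\<close>

theorem theorem2p8:
  fixes \<gamma>0 :: "real \<Rightarrow> real ^ 'm::finite option"
    and g0 :: "real \<Rightarrow> real ^ 'm option ^ 'm option"
    and k z :: "real \<Rightarrow> real \<Rightarrow> real ^ 'm"
    and \<xi> :: "real \<Rightarrow> real \<Rightarrow> real ^ 'm ^ 'm"
    and g :: "real \<Rightarrow> real \<Rightarrow> real ^ 'm option ^ 'm option"
    and Z \<gamma> :: "real \<Rightarrow> real \<Rightarrow> real ^ 'm option"
    and c :: "real \<Rightarrow> real ^ 'm option"
  assumes \<gamma>0_smooth: "smooth \<gamma>0"
    and \<gamma>0_arc_length: "\<And>x. norm (D \<gamma>0 x) = 1"
    and \<gamma>0_periodic: "\<And>x. \<gamma>0 (x + 2 * pi) = \<gamma>0 x"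
    and holonomy: "trivial_normal_holonomy \<gamma>0 (2 * pi)"
    and g0_frame: "parallel_frame \<gamma>0 g0"
    and k_smooth: "smooth (\<lambda>(x, t). k x t)"
    and k_pde: "\<And>x t. Dt k x t =
      - (Dx (Dx (Dx k)) x t + (3 / 2 * (norm (k x t))\<^sup>2) *\<^sub>R Dx k x t)"
    and k_init: "\<And>x. k x 0 = principal_curvatures g0 x"
    and k_periodic: "\<And>x t. k (x + 2 * pi) t = k x t"
    and z_eq: "\<And>x t. z x t = - (Dx (Dx k) x t + (1 / 2 * (norm (k x t))\<^sup>2) *\<^sub>R k x t)"
    and \<xi>_eq: "\<And>x t i j. \<xi> x t $ i $ j = Dx k x t $ i * k x t $ j - k x t $ i * Dx k x t $ j"
    and g_SO: "\<And>x t. rotation_matrix (g x t)"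
    and g_diff_x: "\<And>x t. (\<lambda>s. g s t) differentiable at x"
    and g_diff_t: "\<And>x t. (\<lambda>s. g x s) differentiable at t"
    and g_x: "\<And>x t. matrix_inv (g x t) ** Dx g x t = block_matrix (k x t) 0"
    and g_t: "\<And>x t. matrix_inv (g x t) ** Dt g x t = block_matrix (z x t) (\<xi> x t)"
    and g_init: "g 0 0 = g0 0"
    and Z_eq: "\<And>x t. Z x t =
      - (((norm (k x t))\<^sup>2 / 2) *\<^sub>R column None (g x t)
         + (\<Sum>i\<in>UNIV. (Dx k x t $ i) *\<^sub>R column (Some i) (g x t)))"
    and c_eq: "\<And>t. c t = (LBINT t1=ereal 0..ereal t. Z 0 t1)"
    and \<gamma>_eq: "\<And>x t. \<gamma> x t = \<gamma>0 0 + c t + (LBINT s=ereal 0..ereal x. column None (g s t))"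
  shows "((\<forall>x t. g (x + 2 * pi) t = g x t) \<and> (\<forall>x. g x 0 = g0 x)) \<and>
         (geometric_airy_flow \<gamma> \<and> (\<forall>x t. \<gamma> (x + 2 * pi) t = \<gamma> x t) \<and> (\<forall>x. \<gamma> x 0 = \<gamma>0 x))"
proof -
  let ?e = "\<lambda>x t. column None (g x t)"
  let ?f = "\<lambda>i x t. column (Some i) (g x t)"
  let ?U = "\<lambda>x t. block_matrix (k x t) 0" and ?V = "\<lambda>x t. block_matrix (z x t) (\<xi> x t)"

  \<comment> \<open>The differential equations of the frame and its initial value\<close>
  have orth: "orthogonal_matrix (g x t)" for x t
    using g_SO by (simp add: rotation_matrix_def)
  have gx: "((\<lambda>s. g s t) has_vector_derivative g x t ** ?U x t) (at x)" for x t
    using g_diff_x[where x = x and t = t] matrix_inv_mult_eq[OF orth g_x, of x t]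
    by (simp add: vector_derivative_works Dx_def)
  have gt: "((\<lambda>s. g x s) has_vector_derivative g x t ** ?V x t) (at t)" for x t
    using g_diff_t[where x = x and t = t] matrix_inv_mult_eq[OF orth g_t, of x t]
    by (simp add: vector_derivative_works Dt_def)

  have orth0: "orthogonal_matrix (g0 x)" for x
    using g0_frame by (simp add: parallel_frame_def rotation_matrix_def)
  have g_0: "g x 0 = g0 x" for x
  proof (rule orthogonal_solution_unique)
    show "((\<lambda>s. g s 0) has_vector_derivative g x 0 ** ?U x 0) (at x)" for x
      by (rule gx)
    \<comment> \<open>Since \<open>k\<close> starts as the principal curvatures of
      \<open>g0\<close>, the given frame solves the same equation as \<open>g\<close> at time
      0.\<close>
    show "(g0 has_vector_derivative g0 x ** ?U x 0) (at x)" for x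
      unfolding k_init by (rule parallel_frame_derivative[OF g0_frame \<gamma>0_arc_length])
  qed (rule orth orth0 g_init)+

  \<comment> \<open>Periodicity of the frame\<close>
  have Dx_periodic: "Dx h (x + 2 * pi) t = Dx h x t"
    if "\<And>x t. h (x + 2 * pi) t = h x t" for h :: "real \<Rightarrow> real \<Rightarrow> real ^ 'm" and x t
    \<comment> \<open>\<open>vector_derivative\<close> chooses a value satisfying the derivative
      predicate; the predicates at \<open>x + 2 * pi\<close> and \<open>x\<close> coincide, hence so
      do the chosen values.\<close>
    using has_vector_derivative_translate[of "\<lambda>s. h s t" "2 * pi" _ x]
    by (simp add: Dx_def vector_derivative_def that)
  note kx_periodic = Dx_periodic[of k, OF k_periodic]
  note kxx_periodic = Dx_periodic[of "Dx k", OF kx_periodic]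
  have V_periodic: "?V (x + 2 * pi) t = ?V x t" for x t
  proof -
    have "\<xi> (x + 2 * pi) t = \<xi> x t"
      by (simp add: vec_eq_iff \<xi>_eq kx_periodic k_periodic)
    then show ?thesis
      by (simp add: z_eq k_periodic kxx_periodic)
  qed

  have D\<gamma>0: "(\<gamma>0 has_vector_derivative D \<gamma>0 x) (at x)" for x
    unfolding D_def vector_derivative_works[symmetric]
    by (rule smooth_imp_differentiable[OF \<gamma>0_smooth])
  have g0_2pi: "g0 (2 * pi) = g0 0"
  proof -
    \<comment> \<open>The tangent column closes up because \<open>\<gamma>0\<close> is periodic, the
      normal columns because the holonomy is trivial.\<close>
    have "column a (g0 (2 * pi)) = column a (g0 0)" for a
    proof (cases a)
      case None
      have "(\<gamma>0 has_vector_derivative D \<gamma>0 (0 + 2 * pi)) (at 0)"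
        using has_vector_derivative_translate[of \<gamma>0 "2 * pi" _ 0] D\<gamma>0 by (simp only: \<gamma>0_periodic)
      then have "D \<gamma>0 (0 + 2 * pi) = D \<gamma>0 0"
        using D\<gamma>0 vector_derivative_unique_at by blast
      then show ?thesis
        using g0_frame None by (simp add: parallel_frame_def)
    next
      case (Some i)
      have "parallel_normal_field \<gamma>0 (\<lambda>x. column (Some i) (g0 x))"
        using g0_frame by (simp add: parallel_frame_def)
      then show ?thesis
        using holonomy Some by (auto simp: trivial_normal_holonomy_def)
    qed
    then show ?thesis
      by (simp add: column_def vec_eq_iff)
  qed
  \<comment> \<open>Along the lines \<open>x = 0\<close> and \<open>x = 2 * pi\<close> the frame
    satisfies the same equation in \<open>t\<close>, as the coefficient matrix is periodic, and it
    has the same value at time 0.\<close>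
  have g_2pi: "g (0 + 2 * pi) t = g 0 t" for t
  proof (rule orthogonal_solution_unique)
    show "((\<lambda>s. g (0 + 2 * pi) s) has_vector_derivative g (0 + 2 * pi) t ** ?V 0 t) (at t)" for t
      using gt[of "0 + 2 * pi" t] unfolding V_periodic .
    show "((\<lambda>s. g 0 s) has_vector_derivative g 0 t ** ?V 0 t) (at t)" for t
      by (rule gt)
    show "g (0 + 2 * pi) 0 = g 0 0"
      by (simp add: g_0 g0_2pi)
  qed (rule orth)+
  have g_periodic: "g (x + 2 * pi) t = g x t" for x t
  proof (rule orthogonal_solution_unique[where A = "\<lambda>s. g (s + 2 * pi) t"
        and B = "\<lambda>s. g s t" and U = "\<lambda>s. ?U s t" and a = 0])
    show "((\<lambda>s. g (s + 2 * pi) t) has_vector_derivative g (x + 2 * pi) t ** ?U x t) (at x)" for x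
      using gx[where x = "x + 2 * pi" and t = t]
      by (simp only: k_periodic has_vector_derivative_translate[of "\<lambda>s. g s t"])
    show "((\<lambda>s. g s t) has_vector_derivative g x t ** ?U x t) (at x)" for x
      by (rule gx)
    show "g (0 + 2 * pi) t = g 0 t"
      by (rule g_2pi)
  qed (rule orth)+

  \<comment> \<open>Smoothness of the coefficients, the frame and the field \<open>Z\<close>\<close>
  note kx_smooth = smooth_Dx[OF k_smooth]
  note kxx_smooth = smooth_Dx[OF kx_smooth]
  have norm_k_smooth: "smooth (\<lambda>(x, t). (norm (k x t))\<^sup>2 / 2)"
    using smooth_linear[OF bounded_linear_divide[of 2]
        smooth_bilinear[OF bounded_bilinear_inner k_smooth k_smooth]]
    by (simp add: power2_norm_eq_inner case_prod_unfold)
  have z_smooth: "smooth (\<lambda>(x, t). z x t)"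
    using smooth_minus[OF smooth_add[OF kxx_smooth smooth_scaleR[OF norm_k_smooth k_smooth]]]
    by (simp add: z_eq case_prod_unfold)
  have \<xi>_smooth: "smooth (\<lambda>(x, t). \<xi> x t)"
  proof -
    \<comment> \<open>The outer product; \<open>\<xi>\<close> is its antisymmetrization in
      \<open>Dx k\<close> and \<open>k\<close>.\<close>
    define b :: "real ^ 'm \<Rightarrow> real ^ 'm \<Rightarrow> real ^ 'm ^ 'm"
      where "b = (\<lambda>u v. \<chi> i j. u $ i * v $ j)"
    have "bilinear b"
      unfolding bilinear_def b_def
      by (auto intro!: linearI simp: vec_eq_iff algebra_simps)
    then have b: "bounded_bilinear b"
      by (simp add: bilinear_conv_bounded_bilinear)
    have "\<xi> x t = b (Dx k x t) (k x t) - b (k x t) (Dx k x t)" for x t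
      by (simp add: vec_eq_iff \<xi>_eq b_def)
    then show ?thesis
      using smooth_diff[OF smooth_bilinear[OF b kx_smooth k_smooth] smooth_bilinear[OF b k_smooth kx_smooth]]
      by (simp add: case_prod_unfold)
  qed
  have U_smooth: "smooth (\<lambda>(x, t). ?U x t)"
    using smooth_block_matrix[OF k_smooth smooth_const] by (simp add: case_prod_unfold)
  have V_smooth: "smooth (\<lambda>(x, t). ?V x t)"
    using smooth_block_matrix[OF z_smooth \<xi>_smooth] by (simp add: case_prod_unfold)
  have g_smooth: "smooth (\<lambda>(x, t). g x t)"
    by (rule smooth_orthogonal_solution[OF gx gt orth U_smooth V_smooth])
  have col_smooth: "smooth (\<lambda>(x, t). column a (g x t))" for a
    using smooth_linear[OF bounded_linear_column g_smooth] by (simp add: case_prod_unfold)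
  have frame_sum_smooth: "smooth (\<lambda>(x, t). \<Sum>i\<in>UNIV. u x t $ i *\<^sub>R ?f i x t)"
    if "smooth (\<lambda>(x, t). u x t)" for u :: "real \<Rightarrow> real \<Rightarrow> real ^ 'm"
    using that col_smooth unfolding case_prod_unfold
    by (intro smooth_sum smooth_scaleR smooth_linear[OF bounded_linear_vec_nth] finite)
  have Z_smooth: "smooth (\<lambda>(x, t). Z x t)"
    using smooth_minus[OF smooth_add[OF smooth_scaleR[OF norm_k_smooth col_smooth[of None]] frame_sum_smooth[OF kx_smooth]]]
    by (simp add: Z_eq case_prod_unfold)
  have section_cont: "continuous_on UNIV (\<lambda>s. h s t)" "continuous_on UNIV (h t)"
    if "smooth (\<lambda>(x, t). h x t)" for h :: "real \<Rightarrow> real \<Rightarrow> real ^ 'm option" and t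
    using continuous_on_compose2[OF smooth_imp_continuous_on[OF that], of UNIV "\<lambda>s. (s, t)"]
      continuous_on_compose2[OF smooth_imp_continuous_on[OF that], of UNIV "\<lambda>s. (t, s)"]
    by (simp_all add: continuous_on_Pair continuous_on_id)

  \<comment> \<open>Derivatives of the frame vectors and of \<open>Z\<close>\<close>
  have col_x: "((\<lambda>s. column a (g s t)) has_vector_derivative column a (g x t ** ?U x t)) (at x)" for a x t
    by (rule bounded_linear.has_vector_derivative[OF bounded_linear_column gx])
  have e_x: "((\<lambda>s. ?e s t) has_vector_derivative (\<Sum>i\<in>UNIV. k x t $ i *\<^sub>R ?f i x t)) (at x)" for x t
    using col_x[of None] by (simp only: column_mult_block_matrix)
  have f_x: "((\<lambda>s. ?f i s t) has_vector_derivative - (k x t $ i) *\<^sub>R ?e x t) (at x)" for i x t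
    using col_x[of "Some i" t x] by (simp add: column_mult_block_matrix)
  have e_t: "((\<lambda>s. ?e x s) has_vector_derivative (\<Sum>i\<in>UNIV. z x t $ i *\<^sub>R ?f i x t)) (at t)" for x t
    using bounded_linear.has_vector_derivative[OF bounded_linear_column gt, of None]
    by (simp only: column_mult_block_matrix)
  \<comment> \<open>For a normal field with coefficients \<open>u\<close>, the normal part of the
    derivative comes only from the coefficients; the frame vectors contribute the tangential term
    with factor \<open>u \<bullet> k\<close>.\<close>
  have frame_sum_x: "((\<lambda>s. \<Sum>i\<in>UNIV. u s t $ i *\<^sub>R ?f i s t) has_vector_derivative
      (\<Sum>i\<in>UNIV. Dx u x t $ i *\<^sub>R ?f i x t) - (u x t \<bullet> k x t) *\<^sub>R ?e x t) (at x)"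
    if "smooth (\<lambda>(x, t). u x t)" for u :: "real \<Rightarrow> real \<Rightarrow> real ^ 'm" and x t
  proof -
    have "((\<lambda>s. \<Sum>i\<in>UNIV. u s t $ i *\<^sub>R ?f i s t) has_vector_derivative
      (\<Sum>i\<in>UNIV. u x t $ i *\<^sub>R (- (k x t $ i) *\<^sub>R ?e x t) + Dx u x t $ i *\<^sub>R ?f i x t)) (at x)"
      by (intro has_vector_derivative_sum bounded_bilinear.has_vector_derivative[OF bounded_bilinear_scaleR] f_x
          bounded_linear.has_vector_derivative[OF bounded_linear_vec_nth] has_vector_derivative_Dx[OF that])
    then show ?thesis
      by (simp add: inner_vec_def scaleR_sum_left sum_subtractf)
  qed

  text \<open>The right-hand side is \<open>(e\<^sub>1)\<^sub>t\<close>, so the integral of \<open>(e\<^sub>1)\<^sub>t\<close> over \<open>[0, x]\<close> is \<open>Z x t - Z 0 t\<close>.\<close>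
  have Z_x: "((\<lambda>s. Z s t) has_vector_derivative (\<Sum>i\<in>UNIV. z x t $ i *\<^sub>R ?f i x t)) (at x)" for x t
  proof -
    have "((\<lambda>s. k s t \<bullet> k s t) has_vector_derivative k x t \<bullet> Dx k x t + Dx k x t \<bullet> k x t) (at x)"
      by (intro bounded_bilinear.has_vector_derivative[OF bounded_bilinear_inner] has_vector_derivative_Dx[OF k_smooth])
    from bounded_linear.has_vector_derivative[OF bounded_linear_divide[of 2] this]
    have norm_k: "((\<lambda>s. (norm (k s t))\<^sup>2 / 2) has_vector_derivative Dx k x t \<bullet> k x t) (at x)"
      by (simp add: power2_norm_eq_inner inner_commute)
    \<comment> \<open>The two multiples of the tangent cancel: one comes from differentiating half
      the squared norm of \<open>k\<close>, the other from the frame. The remaining normal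
      coefficients are exactly \<open>z\<close>.\<close>
    have "((\<lambda>s. Z s t) has_vector_derivative
        - ((((norm (k x t))\<^sup>2 / 2) *\<^sub>R (\<Sum>i\<in>UNIV. k x t $ i *\<^sub>R ?f i x t) + (Dx k x t \<bullet> k x t) *\<^sub>R ?e x t)
          + ((\<Sum>i\<in>UNIV. Dx (Dx k) x t $ i *\<^sub>R ?f i x t) - (Dx k x t \<bullet> k x t) *\<^sub>R ?e x t))) (at x)"
      unfolding Z_eq
      by (intro has_vector_derivative_minus has_vector_derivative_add frame_sum_x[OF kx_smooth] e_x norm_k
          bounded_bilinear.has_vector_derivative[OF bounded_bilinear_scaleR])
    then show ?thesis
      by (simp add: z_eq scaleR_sum_right sum.distrib[symmetric] sum_negf[symmetric] algebra_simps)
  qed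

  \<comment> \<open>The partial derivatives of the evolving curve\<close>
  have \<gamma>_x: "((\<lambda>s. \<gamma> s t) has_vector_derivative ?e x t) (at x)" for x t
  proof -
    have "((\<lambda>s. \<gamma>0 0 + c t + (LBINT r=ereal 0..ereal s. ?e r t)) has_vector_derivative 0 + 0 + ?e x t) (at x)"
      by (intro has_vector_derivative_add has_vector_derivative_const
          has_vector_derivative_interval_integral_upper section_cont(1)[OF col_smooth])
    then show ?thesis
      by (simp add: \<gamma>_eq)
  qed
  have \<gamma>_t: "((\<lambda>s. \<gamma> x s) has_vector_derivative Z x t) (at t)" for x t
  proof -
    have c_t: "(c has_vector_derivative Z 0 t) (at t)"
      using has_vector_derivative_interval_integral_upper[OF section_cont(2)[OF Z_smooth], of 0 t]
      by (simp add: c_eq[abs_def])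
    have "((\<lambda>s. LBINT r=ereal 0..ereal x. ?e r s) has_vector_derivative
        (LBINT s=ereal 0..ereal x. (\<Sum>i\<in>UNIV. z s t $ i *\<^sub>R ?f i s t))) (at t)"
      by (rule has_vector_derivative_interval_integral_parameter[OF section_cont(1)[OF col_smooth] e_t
            smooth_imp_continuous_on[OF frame_sum_smooth[OF z_smooth]]])
    also have "(LBINT s=ereal 0..ereal x. (\<Sum>i\<in>UNIV. z s t $ i *\<^sub>R ?f i s t)) = Z x t - Z 0 t"
      by (rule interval_integral_FTC_finite)
        (use section_cont(1)[OF frame_sum_smooth[OF z_smooth]] continuous_on_subset Z_x
          has_vector_derivative_at_within in blast)+
    \<comment> \<open>The boundary term \<open>- Z 0 t\<close> is cancelled by the derivative of
      \<open>c\<close>, the motion of the base point.\<close>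
    finally have "((\<lambda>s. \<gamma>0 0 + c s + (LBINT r=ereal 0..ereal x. ?e r s)) has_vector_derivative
        0 + Z 0 t + (Z x t - Z 0 t)) (at t)"
      by (intro has_vector_derivative_add has_vector_derivative_const c_t)
    then show ?thesis
      by (simp add: \<gamma>_eq)
  qed

  \<comment> \<open>Initial value and periodicity of the curve\<close>
  have \<gamma>_0: "\<gamma> x 0 = \<gamma>0 x" for x
  proof -
    have "((\<lambda>s. \<gamma> s 0 - \<gamma>0 s) has_vector_derivative ?e x 0 - D \<gamma>0 x) (at x)" for x
      by (intro has_vector_derivative_diff \<gamma>_x D\<gamma>0)
    then have "((\<lambda>s. \<gamma> s 0 - \<gamma>0 s) has_vector_derivative 0) (at x)" for x
      using g0_frame by (simp add: g_0 parallel_frame_def)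
    then have "\<gamma> x 0 - \<gamma>0 x = \<gamma> 0 0 - \<gamma>0 0"
      by (rule has_vector_derivative_zero_constant)
    also have "\<dots> = 0"
      using interval_integral_endpoints_same[of "ereal 0"] by (simp only: \<gamma>_eq c_eq) simp
    finally show ?thesis by simp
  qed

  have Z_periodic: "Z (x + 2 * pi) t = Z x t" for x t
    by (simp add: Z_eq g_periodic k_periodic kx_periodic)
  have \<gamma>_periodic: "\<gamma> (x + 2 * pi) t = \<gamma> x t" for x t
  proof -
    \<comment> \<open>The closing defect of the curve is constant in \<open>x\<close> by periodicity
      of the tangent, then constant in \<open>t\<close> by periodicity of \<open>Z\<close>, and it
      is zero at time 0, where the curve is \<open>\<gamma>0\<close>.\<close>
    have "((\<lambda>s. \<gamma> (s + 2 * pi) t - \<gamma> s t) has_vector_derivative ?e (x + 2 * pi) t - ?e x t) (at x)" for x t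
      by (intro has_vector_derivative_diff \<gamma>_x has_vector_derivative_translate[THEN iffD2])
    then have "((\<lambda>s. \<gamma> (s + 2 * pi) t - \<gamma> s t) has_vector_derivative 0) (at x)" for x t
      by (simp add: g_periodic)
    then have "\<gamma> (x + 2 * pi) t - \<gamma> x t = \<gamma> (0 + 2 * pi) t - \<gamma> 0 t"
      by (rule has_vector_derivative_zero_constant)
    also have "((\<lambda>t. \<gamma> (0 + 2 * pi) t - \<gamma> 0 t) has_vector_derivative Z (0 + 2 * pi) t - Z 0 t) (at t)" for t
      by (intro has_vector_derivative_diff \<gamma>_t)
    then have "((\<lambda>t. \<gamma> (0 + 2 * pi) t - \<gamma> 0 t) has_vector_derivative 0) (at t)" for t
      unfolding Z_periodic by simp
    then have "\<gamma> (0 + 2 * pi) t - \<gamma> 0 t = \<gamma> (0 + 2 * pi) 0 - \<gamma> 0 0"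
      by (rule has_vector_derivative_zero_constant)
    also have "\<dots> = 0"
      unfolding \<gamma>_0 \<gamma>0_periodic by simp
    finally show ?thesis by simp
  qed

  \<comment> \<open>Both partials, the tangent and \<open>Z\<close>, are smooth, which gives every
    positive order; order 0 follows by descent.\<close>
  have "C_k (Suc m) (\<lambda>(x, t). \<gamma> x t)" for m
    by (rule C_k_Suc_partials[OF \<gamma>_x \<gamma>_t]) (use col_smooth Z_smooth in \<open>auto simp: smooth_def\<close>)
  then have \<gamma>_smooth: "smooth (\<lambda>(x, t). \<gamma> x t)"
    using C_k_SucD smooth_def by blast

  \<comment> \<open>The flow equation expressed in the frame\<close>
  have cols: "column a (g x t) \<bullet> column b (g x t) = (if a = b then 1 else 0)" for a b x t
    by (rule rotation_matrix_columns[OF g_SO])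
  have norm_e: "norm (?e x t) = 1" for x t
    by (simp add: norm_eq_1 cols)
  have D\<gamma>: "D (\<lambda>s. \<gamma> s t) x = ?e x t" for x t
    by (simp add: D_def vector_derivative_at[OF \<gamma>_x])
  have tangent: "unit_tangent (\<lambda>s. \<gamma> s t) = (\<lambda>x. ?e x t)" for t
    by (simp add: fun_eq_iff unit_tangent_def D\<gamma> norm_e)
  have frame_sum_e: "(\<Sum>i\<in>UNIV. u $ i *\<^sub>R ?f i x t) \<bullet> ?e x t = 0" for u :: "real ^ 'm" and x t
    by (simp add: inner_sum_left cols)
  have frame_sum_norm: "(norm (\<Sum>i\<in>UNIV. u $ i *\<^sub>R ?f i x t))\<^sup>2 = (norm u)\<^sup>2" for u :: "real ^ 'm" and x t
    unfolding power2_norm_eq_inner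
    by (simp add: inner_sum_left inner_sum_right cols inner_vec_def[of u u]
        if_distrib[of "(*) _"] cong: if_cong)
  have ee: "?e x t \<bullet> ?e x t = 1" for x t
    by (simp add: cols)
  have H: "mean_curvature (\<lambda>s. \<gamma> s t) = (\<lambda>x. \<Sum>i\<in>UNIV. k x t $ i *\<^sub>R ?f i x t)" for t
  proof -
    have "D (\<lambda>x. ?e x t) x = (\<Sum>i\<in>UNIV. k x t $ i *\<^sub>R ?f i x t)" for x
      unfolding D_def by (rule vector_derivative_at[OF e_x])
    \<comment> \<open>The speed is 1 and the derivative of the tangent is already normal, so neither
      normalization nor projection changes it.\<close>
    then show ?thesis
      by (simp add: fun_eq_iff mean_curvature_def normal_deriv_def normal_part_def tangent D\<gamma> norm_e frame_sum_e)
  qed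
  have DH: "normal_deriv (\<lambda>s. \<gamma> s t) (\<lambda>x. \<Sum>i\<in>UNIV. k x t $ i *\<^sub>R ?f i x t) x =
      (\<Sum>i\<in>UNIV. Dx k x t $ i *\<^sub>R ?f i x t)" for x t
  proof -
    have "D (\<lambda>x. \<Sum>i\<in>UNIV. k x t $ i *\<^sub>R ?f i x t) x =
      (\<Sum>i\<in>UNIV. Dx k x t $ i *\<^sub>R ?f i x t) - (k x t \<bullet> k x t) *\<^sub>R ?e x t"
      unfolding D_def by (rule vector_derivative_at[OF frame_sum_x[OF k_smooth]])
    \<comment> \<open>The projection removes the tangential term with factor
      \<open>k x t \<bullet> k x t\<close>.\<close>
    then show ?thesis
      by (simp add: normal_deriv_def normal_part_def tangent D\<gamma> norm_e inner_diff_left frame_sum_e ee)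
  qed
  have "geometric_airy_flow \<gamma>"
    unfolding geometric_airy_flow_def Let_def
  proof (intro conjI allI)
    show "smooth (\<lambda>(x, t). \<gamma> x t)"
      by (rule \<gamma>_smooth)
    show "Dx \<gamma> x t \<noteq> 0" for x t
      using norm_e[of x t] by (auto simp: Dx_def vector_derivative_at[OF \<gamma>_x])
    show "Dt \<gamma> x t = - (((norm (mean_curvature (\<lambda>s. \<gamma> s t) x))\<^sup>2 / 2) *\<^sub>R unit_tangent (\<lambda>s. \<gamma> s t) x
        + normal_deriv (\<lambda>s. \<gamma> s t) (mean_curvature (\<lambda>s. \<gamma> s t)) x)" for x t
      \<comment> \<open>The mean curvature vector has the norm of \<open>k\<close>, so the
        right-hand side is \<open>Z\<close>, the velocity of the curve.\<close>
      unfolding H DH tangent frame_sum_norm by (simp add: Dt_def vector_derivative_at[OF \<gamma>_t] Z_eq)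
  qed
  then show ?thesis
    using g_periodic g_0 \<gamma>_periodic \<gamma>_0 by blast
qed

end
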